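(* Let $n\ge3$ and let $T_n$ be the graph with vertex set $\{1,\ldots,n\}$ and edge set $\{(1,3),(2,3),(3,4),(4,5),\ldots,(n-1,n)\}$. Then the total number of spanning rooted forests of $T_n$ is $f=4\mathcal F_{2n-3}$, and $f_{33}=4\mathcal F_{2n-5}$ and $f_{nn}=4\mathcal F_{2n-4}$.
   Context: $(\mathcal F_k)_{k\ge0}$ are the Fibonacci numbers ($\mathcal F_0=0$, $\mathcal F_1=1$, $\mathcal F_{k+2}=\mathcal F_{k+1}+\mathcal F_k$). A spanning rooted forest of a graph is a spanning acyclic subgraph in which exactly one vertex (the root) is marked in each tree. $f_{ii}$ is the number of spanning rooted forests in which vertex $i$ is a root; $f$ is the total number of spanning rooted forests. $T_n$ is called a T-caterpillar. *)

theory Defs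
  imports "HOL-Number_Theory.Fib"
begin

record 'a ugraph =
  vertices :: "'a set"
  edges :: "'a set set"

definition simple_graph :: "'a ugraph \<Rightarrow> bool" where
  "simple_graph G \<longleftrightarrow> (\<forall>e \<in> edges G. e \<subseteq> vertices G \<and> card e = 2)"

definition adjacent :: "'a ugraph \<Rightarrow> 'a \<Rightarrow> 'a \<Rightarrow> bool" where
  "adjacent G u v \<longleftrightarrow> {u, v} \<in> edges G"

definition spanning_subgraph :: "'a ugraph \<Rightarrow> 'a ugraph \<Rightarrow> bool" where
  "spanning_subgraph H G \<longleftrightarrow> vertices H = vertices G \<and> edges H \<subseteq> edges G"

(* A cycle is given by the list of its distinct vertices, without repeating the first one;
   length at least 3 rules out going back and forth along one edge. *)
definition is_cycle :: "'a ugraph \<Rightarrow> 'a list \<Rightarrow> bool" where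
  "is_cycle G p \<longleftrightarrow> 3 \<le> length p \<and> distinct p \<and> set p \<subseteq> vertices G \<and>
     successively (adjacent G) p \<and> adjacent G (last p) (hd p)"

definition acyclic_graph :: "'a ugraph \<Rightarrow> bool" where
  "acyclic_graph G \<longleftrightarrow> (\<nexists>p. is_cycle G p)"

definition component_of :: "'a ugraph \<Rightarrow> 'a \<Rightarrow> 'a set" where
  "component_of G u = {v \<in> vertices G. (adjacent G)\<^sup>*\<^sup>* u v}"

definition components :: "'a ugraph \<Rightarrow> 'a set set" where
  "components G = component_of G ` vertices G"

(* A rooted forest is a pair of the underlying forest and its set of roots. *)
definition spanning_rooted_forests :: "'a ugraph \<Rightarrow> ('a ugraph \<times> 'a set) set" where
  "spanning_rooted_forests G =
     {(H, R). spanning_subgraph H G \<and> acyclic_graph H \<and>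
        R \<subseteq> vertices H \<and> (\<forall>C \<in> components H. \<exists>!r. r \<in> R \<and> r \<in> C)}"

definition num_rooted_forests :: "'a ugraph \<Rightarrow> nat" where
  "num_rooted_forests G = card (spanning_rooted_forests G)"

definition num_rooted_forests_at :: "'a ugraph \<Rightarrow> 'a \<Rightarrow> nat" where
  "num_rooted_forests_at G i = card {(H, R) \<in> spanning_rooted_forests G. i \<in> R}"

definition T_caterpillar :: "nat \<Rightarrow> nat ugraph" where
  "T_caterpillar n =
     \<lparr>vertices = {1..n}, edges = {{1, 3}, {2, 3}} \<union> {{i, i + 1} | i. 3 \<le> i \<and> i < n}\<rparr>"

lemma simple_graph_T_caterpillar: "3 \<le> n \<Longrightarrow> simple_graph (T_caterpillar n)"
  by (auto simp: simple_graph_def T_caterpillar_def)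

end

theory Submission
  imports Defs
begin

text \<open>
  The caterpillar grows from a single vertex by attaching leaves. Let a leaf \<open>v\<close> be attached to a
  vertex \<open>w\<close> of a graph \<open>G\<close>. A rooted forest of the new graph either omits the new edge, so that
  \<open>v\<close> is an isolated root; or contains it and has its roots in \<open>G\<close>; or contains it and has \<open>v\<close> as a
  root, in which case moving that root to \<open>w\<close> gives a rooted forest of \<open>G\<close> with root \<open>w\<close>. Counting
  the forests whose root set contains a prescribed set, this yields linear recurrences, and along
  a path of successively attached leaves these are the recurrences of consecutive Fibonacci numbers.
  The forests rooted at the end of the path are then what \<open>f\<close> gains, beyond doubling, when one more
  leaf is attached there.
\<close>

section \<open>Cycles and reachability\<close>

lemma ugraph_eqI: "vertices G = vertices H \<Longrightarrow> edges G = edges H \<Longrightarrow> G = (H :: 'a ugraph)"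
  by (cases G; cases H) simp

lemma adjacent_commute: "adjacent G x y \<longleftrightarrow> adjacent G y x"
  by (simp add: adjacent_def insert_commute)

lemma is_cycle_rotate1:
  assumes "is_cycle G p"
  shows "is_cycle G (rotate1 p)"
proof -
  obtain x y q where "p = x # y # q" "q \<noteq> []"
    using assms by (cases p rule: remdups_adj.cases) (fastforce simp: is_cycle_def)+
  then show ?thesis
    using assms by (auto simp: is_cycle_def successively_append_iff successively_Cons)
qed

lemma is_cycle_rotate: "is_cycle G p \<Longrightarrow> is_cycle G (rotate n p)"
  by (induction n) (simp_all add: is_cycle_rotate1)

lemma is_cycle_two_neighboursE:
  assumes cycle: "is_cycle G p" and "v \<in> set p"
  obtains x y where "x \<noteq> y" "adjacent G v x" "adjacent G v y"
proof -
  obtain xs ys where "p = xs @ v # ys"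
    using \<open>v \<in> set p\<close> by (meson split_list)
  then have "is_cycle G (v # ys @ xs)"
    using is_cycle_rotate[OF cycle, of "length xs"] by (simp add: rotate_append)
  then obtain x q where "is_cycle G (v # x # q)" "q \<noteq> []"
    by (cases "ys @ xs") (fastforce simp: is_cycle_def)+
  then have "adjacent G v x" "adjacent G (last q) v" "x \<noteq> last q"
    by (auto simp: is_cycle_def)
  then show thesis
    using that adjacent_commute by metis
qed

lemma is_cycle_transfer:
  assumes "is_cycle G p" "set p \<subseteq> vertices H"
    and "\<And>x y. x \<in> set p \<Longrightarrow> y \<in> set p \<Longrightarrow> adjacent G x y \<Longrightarrow> adjacent H x y"
  shows "is_cycle H p"
proof -
  have "p \<noteq> []"
    using assms(1) by (auto simp: is_cycle_def)
  then show ?thesis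
    using assms by (auto simp: is_cycle_def elim!: successively_mono)
qed

lemma acyclic_graph_mono:
  assumes "acyclic_graph G" "vertices H \<subseteq> vertices G" "edges H \<subseteq> edges G"
  shows "acyclic_graph H"
proof -
  have "is_cycle G p" if "is_cycle H p" for p
    using that
    by (rule is_cycle_transfer) (use that assms in \<open>auto simp: is_cycle_def adjacent_def\<close>)
  then show ?thesis
    using assms(1) by (auto simp: acyclic_graph_def)
qed

lemma acyclic_graph_insert_vertex:
  assumes "acyclic_graph G" "vertices H \<subseteq> insert v (vertices G)"
    and old: "\<And>x y. x \<noteq> v \<Longrightarrow> y \<noteq> v \<Longrightarrow> adjacent H x y \<Longrightarrow> adjacent G x y"
    and degree_le_1: "\<And>x y. adjacent H v x \<Longrightarrow> adjacent H v y \<Longrightarrow> x = y"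
  shows "acyclic_graph H"
  unfolding acyclic_graph_def
proof
  assume "\<exists>p. is_cycle H p"
  then obtain p where cycle: "is_cycle H p" ..
  have "v \<notin> set p"
    using is_cycle_two_neighboursE[OF cycle] degree_le_1 by metis
  then have "is_cycle G p"
    using cycle assms(2) by (intro is_cycle_transfer[OF cycle] old) (auto simp: is_cycle_def)
  then show False
    using \<open>acyclic_graph G\<close> by (auto simp: acyclic_graph_def)
qed

abbreviation reachable :: "'a ugraph \<Rightarrow> 'a \<Rightarrow> 'a \<Rightarrow> bool" where
  "reachable G \<equiv> (adjacent G)\<^sup>*\<^sup>*"

section \<open>Root sets\<close>

definition root_set :: "'a ugraph \<Rightarrow> 'a set \<Rightarrow> bool" where
  "root_set H R \<longleftrightarrow> R \<subseteq> vertices H \<and> (\<forall>C \<in> components H. \<exists>!r. r \<in> R \<and> r \<in> C)"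

lemma root_set_subset: "root_set H R \<Longrightarrow> R \<subseteq> vertices H"
  by (simp add: root_set_def)

lemma root_set_iff_reachable:
  "root_set H R \<longleftrightarrow>
     R \<subseteq> vertices H \<and> (\<forall>u \<in> vertices H. \<exists>!r. r \<in> R \<and> reachable H u r)"
proof -
  have "r \<in> R \<and> r \<in> component_of H u \<longleftrightarrow> r \<in> R \<and> reachable H u r" if "R \<subseteq> vertices H" for r u
    using that by (auto simp: component_of_def)
  then show ?thesis
    by (cases "R \<subseteq> vertices H") (simp_all add: root_set_def components_def)
qed

lemma ex1_image_iff:
  assumes "inj_on f A"
  shows "(\<exists>!y. y \<in> f ` A \<and> P y) \<longleftrightarrow> (\<exists>!x. x \<in> A \<and> P (f x))"
  using assms unfolding inj_on_def Ex1_def by blast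

lemma root_set_iff_image:
  assumes image: "f ` vertices G = vertices H"
    and reachable: "\<And>x y. reachable G x y \<longleftrightarrow> reachable H (f x) (f y)"
    and "R \<subseteq> vertices G"
  shows "root_set G R \<longleftrightarrow> inj_on f R \<and> root_set H (f ` R)"
proof -
  have "inj_on f R" if "root_set G R"
  proof (rule inj_onI)
    fix r s
    assume "r \<in> R" "s \<in> R" "f r = f s"
    then have "reachable G r s"
      by (simp add: reachable)
    then show "r = s"
      using that \<open>r \<in> R\<close> \<open>s \<in> R\<close> by (auto simp: root_set_iff_reachable)
  qed
  moreover have "root_set G R \<longleftrightarrow> root_set H (f ` R)" if "inj_on f R"
    using \<open>R \<subseteq> vertices G\<close>
    by (auto simp: root_set_iff_reachable reachable ex1_image_iff[OF that] simp flip: image)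
  ultimately show ?thesis
    by blast
qed

definition root_sets :: "'a ugraph \<Rightarrow> 'a set \<Rightarrow> 'a set set" where
  "root_sets H S = {R. root_set H R \<and> S \<subseteq> R}"

lemma finite_root_sets: "finite (vertices H) \<Longrightarrow> finite (root_sets H S)"
  by (rule finite_subset[of _ "Pow (vertices H)"]) (auto simp: root_sets_def dest: root_set_subset)

definition spanning_forests :: "'a ugraph \<Rightarrow> 'a ugraph set" where
  "spanning_forests G = {H. spanning_subgraph H G \<and> acyclic_graph H}"

lemma finite_spanning_forests:
  assumes "finite (vertices G)" "edges G \<subseteq> Pow (vertices G)"
  shows "finite (spanning_forests G)"
proof (rule finite_surj)
  show "finite (Pow (edges G))"
    using assms by (auto intro: finite_subset)
  show "spanning_forests G \<subseteq> (\<lambda>E. \<lparr>vertices = vertices G, edges = E\<rparr>) ` Pow (edges G)"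
    by (auto simp: spanning_forests_def spanning_subgraph_def intro!: image_eqI ugraph_eqI)
qed

definition num_forests_with_roots :: "'a ugraph \<Rightarrow> 'a set \<Rightarrow> nat" where
  "num_forests_with_roots G S = card {(H, R) \<in> spanning_rooted_forests G. S \<subseteq> R}"

lemma num_rooted_forests_eq: "num_rooted_forests G = num_forests_with_roots G {}"
  by (simp add: num_rooted_forests_def num_forests_with_roots_def)

lemma num_rooted_forests_at_eq: "num_rooted_forests_at G i = num_forests_with_roots G {i}"
  by (simp add: num_rooted_forests_at_def num_forests_with_roots_def)

lemma num_forests_with_roots_eq_sum:
  assumes "finite (vertices G)" "edges G \<subseteq> Pow (vertices G)"
  shows "num_forests_with_roots G S = (\<Sum>H \<in> spanning_forests G. card (root_sets H S))"
proof -
  have "{(H, R) \<in> spanning_rooted_forests G. S \<subseteq> R} =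
      (SIGMA H : spanning_forests G. root_sets H S)"
    by (auto simp: spanning_rooted_forests_def spanning_forests_def root_sets_def root_set_def)
  moreover have "finite (root_sets H S)" if "H \<in> spanning_forests G" for H
    using that assms(1)
    by (intro finite_root_sets) (simp add: spanning_forests_def spanning_subgraph_def)
  ultimately show ?thesis
    using finite_spanning_forests[OF assms] by (simp add: num_forests_with_roots_def)
qed

section \<open>Attaching a leaf\<close>

definition add_vertex :: "'a ugraph \<Rightarrow> 'a \<Rightarrow> 'a ugraph" where
  "add_vertex G v = \<lparr>vertices = insert v (vertices G), edges = edges G\<rparr>"

definition add_leaf :: "'a ugraph \<Rightarrow> 'a \<Rightarrow> 'a \<Rightarrow> 'a ugraph" where
  "add_leaf G w v = \<lparr>vertices = insert v (vertices G), edges = insert {w, v} (edges G)\<rparr>"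

definition delete_vertex :: "'a ugraph \<Rightarrow> 'a \<Rightarrow> 'a ugraph" where
  "delete_vertex G v = \<lparr>vertices = vertices G - {v}, edges = {e \<in> edges G. v \<notin> e}\<rparr>"

lemma add_vertex_simps [simp]:
  "vertices (add_vertex G v) = insert v (vertices G)"
  "edges (add_vertex G v) = edges G"
  by (simp_all add: add_vertex_def)

lemma add_leaf_simps [simp]:
  "vertices (add_leaf G w v) = insert v (vertices G)"
  "edges (add_leaf G w v) = insert {w, v} (edges G)"
  by (simp_all add: add_leaf_def)

lemma delete_vertex_simps [simp]:
  "vertices (delete_vertex G v) = vertices G - {v}"
  "edges (delete_vertex G v) = {e \<in> edges G. v \<notin> e}"
  by (simp_all add: delete_vertex_def)

lemma adjacent_add_vertex: "adjacent (add_vertex G v) = adjacent G"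
  by (simp add: adjacent_def fun_eq_iff)

lemma adjacent_add_leaf_iff:
  "adjacent (add_leaf G w v) x y \<longleftrightarrow> adjacent G x y \<or> (x = w \<and> y = v) \<or> (x = v \<and> y = w)"
  by (auto simp: adjacent_def doubleton_eq_iff)

locale new_vertex =
  fixes G :: "'a ugraph" and v :: 'a
  assumes edges_subset: "edges G \<subseteq> Pow (vertices G)" and v_notin: "v \<notin> vertices G"
begin

lemma spanning_subgraph_new_vertex: "spanning_subgraph K G \<Longrightarrow> new_vertex K v"
  using edges_subset v_notin by unfold_locales (auto simp: spanning_subgraph_def)

lemma not_adjacent_v: "\<not> adjacent G v x" "\<not> adjacent G x v"
  using edges_subset v_notin by (auto simp: adjacent_def)

lemma reachable_v_iff: "reachable G v x \<longleftrightarrow> x = v" "reachable G x v \<longleftrightarrow> x = v"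
  using not_adjacent_v
  by (metis converse_rtranclpE rtranclp.rtrancl_refl, metis rtranclp.cases rtranclp.rtrancl_refl)

lemma delete_add_vertex: "delete_vertex (add_vertex G v) v = G"
  using edges_subset v_notin by (intro ugraph_eqI) auto

lemma acyclic_add_vertex_iff: "acyclic_graph (add_vertex G v) \<longleftrightarrow> acyclic_graph G"
proof
  assume "acyclic_graph G"
  then show "acyclic_graph (add_vertex G v)"
    by (rule acyclic_graph_insert_vertex[where v = v])
      (auto simp: adjacent_add_vertex not_adjacent_v)
qed (auto elim: acyclic_graph_mono)

lemma root_set_add_vertex_iff: "root_set (add_vertex G v) R \<longleftrightarrow> v \<in> R \<and> root_set G (R - {v})"
proof -
  have "r \<in> R \<and> reachable G u r \<longleftrightarrow> r \<in> R - {v} \<and> reachable G u r"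
    if "u \<in> vertices G" for u r
    using that v_notin by (auto simp: reachable_v_iff)
  then show ?thesis
    by (auto simp: root_set_iff_reachable adjacent_add_vertex reachable_v_iff)
qed

lemma v_notin_root_sets: "R \<in> root_sets G S \<Longrightarrow> v \<notin> R"
  using v_notin by (auto simp: root_sets_def dest: root_set_subset)

lemma card_root_sets_add_vertex:
  "card (root_sets (add_vertex G v) S) = card (root_sets G (S - {v}))"
proof -
  have "root_sets (add_vertex G v) S = insert v ` root_sets G (S - {v})"
    using v_notin_root_sets
    by (auto simp: root_sets_def root_set_add_vertex_iff intro!: rev_image_eqI)
  moreover have "inj_on (insert v) (root_sets G (S - {v}))"
    using v_notin_root_sets by (intro inj_on_inverseI[where g = "\<lambda>R. R - {v}"]) simp
  ultimately show ?thesis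
    by (simp add: card_image)
qed

end

locale leaf_attachment = new_vertex G v for G :: "'a ugraph" and w v :: 'a +
  assumes w_in: "w \<in> vertices G"
begin

lemma w_neq_v: "w \<noteq> v"
  using w_in v_notin by auto

lemma spanning_subgraph_leaf_attachment: "spanning_subgraph K G \<Longrightarrow> leaf_attachment K w v"
  using w_in by (auto simp: leaf_attachment_def leaf_attachment_axioms_def
      spanning_subgraph_new_vertex spanning_subgraph_def)

lemma delete_add_leaf: "delete_vertex (add_leaf G w v) v = G"
  using edges_subset v_notin by (intro ugraph_eqI) auto

lemma acyclic_add_leaf_iff: "acyclic_graph (add_leaf G w v) \<longleftrightarrow> acyclic_graph G"
proof
  assume "acyclic_graph G"
  then show "acyclic_graph (add_leaf G w v)"
    by (rule acyclic_graph_insert_vertex[where v = v])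
      (auto simp: adjacent_add_leaf_iff not_adjacent_v)
qed (auto elim: acyclic_graph_mono)

abbreviation contract :: "'a \<Rightarrow> 'a" where
  "contract \<equiv> id(v := w)"

lemma reachable_add_leaf_iff:
  "reachable (add_leaf G w v) x y \<longleftrightarrow> reachable G (contract x) (contract y)"
proof
  assume "reachable (add_leaf G w v) x y"
  then show "reachable G (contract x) (contract y)"
  proof induction
    case (step y z)
    from step.hyps(2) have "contract y = contract z \<or> adjacent G (contract y) (contract z)"
      using w_neq_v by (auto simp: adjacent_add_leaf_iff not_adjacent_v)
    with step.IH show ?case
      by (metis rtranclp.rtrancl_into_rtrancl)
  qed simp
next
  assume "reachable G (contract x) (contract y)"
  then have "reachable (add_leaf G w v) (contract x) (contract y)"
    by (rule rtranclp_mono[THEN predicate2D, rotated]) (auto simp: adjacent_add_leaf_iff)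
  moreover have "reachable (add_leaf G w v) z (contract z)"
    "reachable (add_leaf G w v) (contract z) z" for z
    by (auto simp: adjacent_add_leaf_iff)
  ultimately show "reachable (add_leaf G w v) x y"
    by (meson rtranclp_trans)
qed

lemma root_set_add_leaf_iff:
  "root_set (add_leaf G w v) R \<longleftrightarrow>
     (if v \<in> R then w \<notin> R \<and> root_set G (insert w (R - {v})) else root_set G R)"
proof (cases "R \<subseteq> insert v (vertices G)")
  case True
  have "contract ` vertices (add_leaf G w v) = vertices G"
    using w_in v_notin by (auto simp: fun_upd_image)
  then have "root_set (add_leaf G w v) R \<longleftrightarrow> inj_on contract R \<and> root_set G (contract ` R)"
    using True by (intro root_set_iff_image) (simp_all add: reachable_add_leaf_iff)
  moreover have "inj_on contract R \<longleftrightarrow> v \<notin> R \<or> w \<notin> R"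
    using w_neq_v by (auto simp: inj_on_def)
  moreover have "contract ` R = (if v \<in> R then insert w (R - {v}) else R)"
    by (auto simp: fun_upd_image)
  ultimately show ?thesis
    by simp
next
  case False
  then show ?thesis
    by (auto dest!: root_set_subset)
qed

lemma root_sets_add_leaf:
  "root_sets (add_leaf G w v) S =
     (if v \<in> S then {} else root_sets G S) \<union>
     (if w \<in> S then {} else (\<lambda>R. insert v (R - {w})) ` root_sets G (insert w (S - {v})))"
    (is "_ = ?same \<union> ?moved")
proof (intro equalityI subsetI)
  fix R
  assume R: "R \<in> root_sets (add_leaf G w v) S"
  show "R \<in> ?same \<union> ?moved"
  proof (cases "v \<in> R")
    case True
    with R have "w \<notin> R" "w \<notin> S"
      and moved: "insert w (R - {v}) \<in> root_sets G (insert w (S - {v}))"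
      by (auto simp: root_sets_def root_set_add_leaf_iff)
    have "R \<in> (\<lambda>R. insert v (R - {w})) ` root_sets G (insert w (S - {v}))"
      by (rule image_eqI[OF _ moved]) (use True \<open>w \<notin> R\<close> in auto)
    then show ?thesis
      using \<open>w \<notin> S\<close> by simp
  next
    case False
    with R show ?thesis
      by (auto simp: root_sets_def root_set_add_leaf_iff)
  qed
next
  fix R
  assume "R \<in> ?same \<union> ?moved"
  then show "R \<in> root_sets (add_leaf G w v) S"
    using v_notin_root_sets w_neq_v
    by (auto simp: root_sets_def root_set_add_leaf_iff insert_absorb split: if_splits)
qed

lemma card_root_sets_add_leaf:
  assumes "finite (vertices G)"
  shows "card (root_sets (add_leaf G w v) S) =
    (if v \<in> S then 0 else card (root_sets G S)) +
    (if w \<in> S then 0 else card (root_sets G (insert w (S - {v}))))"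
proof -
  let ?move = "\<lambda>R. insert v (R - {w})"
  have "inj_on ?move (root_sets G (insert w T))" for T
    using v_notin_root_sets by (intro inj_on_inverseI[where g = "\<lambda>R. insert w (R - {v})"])
      (auto simp: root_sets_def)
  moreover have "root_sets G S \<inter> ?move ` root_sets G (insert w T) = {}" for T
    using v_notin_root_sets by auto
  ultimately show ?thesis
    using assms by (simp add: root_sets_add_leaf card_Un_disjoint card_image finite_root_sets)
qed

lemma spanning_subgraph_add_leaf_iff:
  "spanning_subgraph K (add_leaf G w v) \<longleftrightarrow>
     (\<exists>L. spanning_subgraph L G \<and> (K = add_vertex L v \<or> K = add_leaf L w v))"
proof
  assume K: "spanning_subgraph K (add_leaf G w v)"
  have "v \<in> vertices K"
    using K by (simp add: spanning_subgraph_def)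
  have edges: "{e \<in> edges K. v \<notin> e} = edges K - {{w, v}}"
    using K edges_subset v_notin by (auto simp: spanning_subgraph_def)
  have "spanning_subgraph (delete_vertex K v) G"
    using K v_notin by (auto simp: spanning_subgraph_def)
  moreover have "K = add_leaf (delete_vertex K v) w v" if "{w, v} \<in> edges K"
    using that \<open>v \<in> vertices K\<close> by (intro ugraph_eqI) (simp_all add: edges insert_absorb)
  moreover have "K = add_vertex (delete_vertex K v) v" if "{w, v} \<notin> edges K"
    using that \<open>v \<in> vertices K\<close> by (intro ugraph_eqI) (simp_all add: edges insert_absorb)
  ultimately show "\<exists>L. spanning_subgraph L G \<and> (K = add_vertex L v \<or> K = add_leaf L w v)"
    by blast
qed (auto simp: spanning_subgraph_def)

lemma spanning_forests_add_leaf: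
  "spanning_forests (add_leaf G w v) =
     (\<lambda>K. add_vertex K v) ` spanning_forests G \<union> (\<lambda>K. add_leaf K w v) ` spanning_forests G"
proof -
  have "acyclic_graph (add_vertex K v) \<longleftrightarrow> acyclic_graph K"
    "acyclic_graph (add_leaf K w v) \<longleftrightarrow> acyclic_graph K" if "spanning_subgraph K G" for K
    using that by (simp_all add: new_vertex.acyclic_add_vertex_iff[OF spanning_subgraph_new_vertex]
        leaf_attachment.acyclic_add_leaf_iff[OF spanning_subgraph_leaf_attachment])
  then show ?thesis
    by (auto simp: spanning_forests_def spanning_subgraph_add_leaf_iff)
qed

lemma sum_spanning_forests_add_leaf:
  assumes "finite (vertices G)"
  shows "(\<Sum>H \<in> spanning_forests (add_leaf G w v). f H) =
    (\<Sum>K \<in> spanning_forests G. f (add_vertex K v)) + (\<Sum>K \<in> spanning_forests G. f (add_leaf K w v))"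
proof -
  have attachment: "new_vertex K v" "leaf_attachment K w v" if "K \<in> spanning_forests G" for K
    using that by (simp_all add: spanning_forests_def spanning_subgraph_new_vertex
        spanning_subgraph_leaf_attachment)
  have "inj_on (\<lambda>K. add_vertex K v) (spanning_forests G)"
    by (intro inj_on_inverseI[where g = "\<lambda>H. delete_vertex H v"])
      (simp add: new_vertex.delete_add_vertex[OF attachment(1)])
  moreover have "inj_on (\<lambda>K. add_leaf K w v) (spanning_forests G)"
    by (intro inj_on_inverseI[where g = "\<lambda>H. delete_vertex H v"])
      (simp add: leaf_attachment.delete_add_leaf[OF attachment(2)])
  moreover have "add_vertex K v \<noteq> add_leaf L w v" if "K \<in> spanning_forests G" for K L
  proof -
    have "{w, v} \<notin> edges (add_vertex K v)"
      using new_vertex.edges_subset new_vertex.v_notin attachment(1)[OF that] by fastforce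
    then show ?thesis
      by (metis add_leaf_simps(2) insertI1)
  qed
  then have "(\<lambda>K. add_vertex K v) ` spanning_forests G \<inter>
      (\<lambda>K. add_leaf K w v) ` spanning_forests G = {}"
    by auto
  ultimately show ?thesis
    using finite_spanning_forests[OF assms edges_subset]
    by (simp add: spanning_forests_add_leaf sum.union_disjoint sum.reindex)
qed

theorem num_forests_with_roots_add_leaf:
  assumes finite: "finite (vertices G)"
  shows "num_forests_with_roots (add_leaf G w v) S =
    num_forests_with_roots G (S - {v}) +
    (if v \<in> S then 0 else num_forests_with_roots G S) +
    (if w \<in> S then 0 else num_forests_with_roots G (insert w (S - {v})))"
proof -
  have attachment: "new_vertex K v" "leaf_attachment K w v" "finite (vertices K)"
    if "K \<in> spanning_forests G" for K
    using that finite by (simp_all add: spanning_forests_def spanning_subgraph_new_vertex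
        spanning_subgraph_leaf_attachment) (simp add: spanning_subgraph_def)
  have "edges (add_leaf G w v) \<subseteq> Pow (vertices (add_leaf G w v))"
    using edges_subset w_in by auto
  then have "num_forests_with_roots (add_leaf G w v) S =
      (\<Sum>K \<in> spanning_forests G. card (root_sets (add_vertex K v) S)) +
      (\<Sum>K \<in> spanning_forests G. card (root_sets (add_leaf K w v) S))"
    using finite by (simp add: num_forests_with_roots_eq_sum sum_spanning_forests_add_leaf)
  then show ?thesis
    using finite edges_subset
    by (simp add: num_forests_with_roots_eq_sum new_vertex.card_root_sets_add_vertex
        leaf_attachment.card_root_sets_add_leaf attachment sum.distrib)
qed

end

section \<open>Pendant paths\<close>

primrec add_path :: "'a ugraph \<Rightarrow> 'a \<Rightarrow> 'a list \<Rightarrow> 'a ugraph" where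
  "add_path G w [] = G"
| "add_path G w (v # vs) = add_path (add_leaf G w v) v vs"

lemma add_path_snoc:
  "add_path G w (vs @ [v]) = add_leaf (add_path G w vs) (last (w # vs)) v"
  by (induction vs arbitrary: G w) auto

theorem num_forests_with_roots_add_path:
  assumes "finite (vertices G)" "edges G \<subseteq> Pow (vertices G)" "w \<in> vertices G"
    and "S \<subseteq> vertices G" "distinct vs" "set vs \<inter> vertices G = {}"
  shows "num_forests_with_roots (add_path G w vs) S =
    num_forests_with_roots G S * fib (2 * length vs + 1) +
    (if w \<in> S then 0 else num_forests_with_roots G (insert w S)) * fib (2 * length vs)"
  using assms
proof (induction vs arbitrary: G w)
  case (Cons v vs)
  interpret leaf_attachment G w v
    using Cons.prems by unfold_locales auto
  define total rooted_w where "total = num_forests_with_roots G S"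
    and "rooted_w = (if w \<in> S then 0 else num_forests_with_roots G (insert w S))"
  have "v \<notin> S"
    using Cons.prems by auto
  then have "num_forests_with_roots (add_leaf G w v) S = 2 * total + rooted_w"
    "num_forests_with_roots (add_leaf G w v) (insert v S) = total + rooted_w"
    using Cons.prems(1) w_neq_v
    by (auto simp: num_forests_with_roots_add_leaf total_def rooted_w_def)
  moreover have "num_forests_with_roots (add_path (add_leaf G w v) v vs) S =
      num_forests_with_roots (add_leaf G w v) S * fib (2 * length vs + 1) +
      (if v \<in> S then 0 else num_forests_with_roots (add_leaf G w v) (insert v S)) *
        fib (2 * length vs)"
    using Cons.prems by (intro Cons.IH) auto
  ultimately have "num_forests_with_roots (add_path G w (v # vs)) S =
      (2 * total + rooted_w) * fib (2 * length vs + 1) + (total + rooted_w) * fib (2 * length vs)"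
    using \<open>v \<notin> S\<close> by simp
  also have "\<dots> = total * fib (2 * length (v # vs) + 1) + rooted_w * fib (2 * length (v # vs))"
    by (simp add: algebra_simps)
  finally show ?case
    by (simp only: total_def rooted_w_def)
qed simp

section \<open>T-caterpillars\<close>

lemma num_forests_with_roots_singleton:
  assumes "S \<subseteq> {a}"
  shows "num_forests_with_roots \<lparr>vertices = {a}, edges = {}\<rparr> S = 1"
proof -
  let ?G = "\<lparr>vertices = {a}, edges = {}\<rparr>"
  have adjacent: "adjacent ?G = bot"
    by (simp add: adjacent_def fun_eq_iff)
  have "root_sets ?G S = {{a}}"
    using assms by (auto simp: root_sets_def root_set_iff_reachable adjacent)
  moreover have "spanning_forests ?G = {?G}"
    by (auto simp: spanning_forests_def spanning_subgraph_def acyclic_graph_def is_cycle_def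
        adjacent intro: ugraph_eqI)
  ultimately show ?thesis
    by (simp add: num_forests_with_roots_eq_sum)
qed

lemma num_forests_with_roots_T_caterpillar_3:
  "num_forests_with_roots (T_caterpillar 3) {} = 8"
  "num_forests_with_roots (T_caterpillar 3) {3} = 4"
proof -
  let ?G = "\<lparr>vertices = {3::nat}, edges = {}\<rparr>"
  interpret edge: leaf_attachment ?G 3 1
    by unfold_locales auto
  interpret star: leaf_attachment "add_leaf ?G 3 1" 3 2
    by unfold_locales auto
  have "T_caterpillar 3 = add_leaf (add_leaf ?G 3 1) 3 2"
    by (rule ugraph_eqI) (auto simp: T_caterpillar_def)
  then show "num_forests_with_roots (T_caterpillar 3) {} = 8"
    "num_forests_with_roots (T_caterpillar 3) {3} = 4"
    by (simp_all add: star.num_forests_with_roots_add_leaf edge.num_forests_with_roots_add_leaf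
        num_forests_with_roots_singleton del: One_nat_def)
qed

lemma T_caterpillar_Suc:
  "3 \<le> n \<Longrightarrow> T_caterpillar (Suc n) = add_leaf (T_caterpillar n) n (Suc n)"
  by (rule ugraph_eqI) (auto simp: T_caterpillar_def less_Suc_eq)

lemma T_caterpillar_eq_add_path:
  "T_caterpillar (k + 3) = add_path (T_caterpillar 3) 3 [4..<k + 4]"
proof (induction k)
  case (Suc k)
  have "T_caterpillar (Suc k + 3) = add_leaf (T_caterpillar (k + 3)) (k + 3) (k + 4)"
    using T_caterpillar_Suc[of "k + 3"] by (simp add: numeral_eq_Suc)
  also have "\<dots> = add_path (T_caterpillar 3) 3 ([4..<k + 4] @ [k + 4])"
  proof -
    have "last (3 # [4..<k + 4]) = k + 3"
      by simp
    then show ?thesis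
      by (simp only: Suc.IH add_path_snoc)
  qed
  also have "[4..<k + 4] @ [k + 4] = [4..<Suc k + 4]"
    by (simp only: add_Suc upt_Suc_append le_add2)
  finally show ?case .
qed simp

lemma num_forests_with_roots_T_caterpillar:
  assumes "S \<subseteq> {1..3}"
  shows "num_forests_with_roots (T_caterpillar (k + 3)) S =
    num_forests_with_roots (T_caterpillar 3) S * fib (2 * k + 1) +
    (if 3 \<in> S then 0 else num_forests_with_roots (T_caterpillar 3) (insert 3 S)) * fib (2 * k)"
  unfolding T_caterpillar_eq_add_path using assms
  by (subst num_forests_with_roots_add_path) (auto simp: T_caterpillar_def)

lemma num_rooted_forests_T_caterpillar:
  "num_rooted_forests (T_caterpillar (k + 3)) = 4 * fib (2 * k + 3)"
proof -
  have "fib (2 * k + 3) = 2 * fib (2 * k + 1) + fib (2 * k)"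
    by (simp add: numeral_3_eq_3)
  then show ?thesis
    by (simp add: num_rooted_forests_eq num_forests_with_roots_T_caterpillar
        num_forests_with_roots_T_caterpillar_3)
qed

lemma num_rooted_forests_at_3_T_caterpillar:
  "num_rooted_forests_at (T_caterpillar (k + 3)) 3 = 4 * fib (2 * k + 1)"
  by (simp add: num_rooted_forests_at_eq num_forests_with_roots_T_caterpillar
      num_forests_with_roots_T_caterpillar_3)

lemma num_rooted_forests_T_caterpillar_Suc:
  assumes "3 \<le> n"
  shows "num_rooted_forests (T_caterpillar (Suc n)) =
    2 * num_rooted_forests (T_caterpillar n) + num_rooted_forests_at (T_caterpillar n) n"
proof -
  interpret leaf_attachment "T_caterpillar n" n "Suc n"
    using assms by unfold_locales (auto simp: T_caterpillar_def)
  have "finite (vertices (T_caterpillar n))"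
    by (simp add: T_caterpillar_def)
  then show ?thesis
    using assms by (simp add: num_rooted_forests_eq num_rooted_forests_at_eq T_caterpillar_Suc
        num_forests_with_roots_add_leaf)
qed

lemma num_rooted_forests_at_last_T_caterpillar:
  "num_rooted_forests_at (T_caterpillar (k + 3)) (k + 3) = 4 * fib (2 * k + 2)"
proof -
  have "num_rooted_forests (T_caterpillar (Suc k + 3)) =
      2 * num_rooted_forests (T_caterpillar (k + 3)) +
      num_rooted_forests_at (T_caterpillar (k + 3)) (k + 3)"
    using num_rooted_forests_T_caterpillar_Suc[of "k + 3"] by simp
  then have "4 * fib (2 * Suc k + 3) =
      2 * (4 * fib (2 * k + 3)) + num_rooted_forests_at (T_caterpillar (k + 3)) (k + 3)"
    by (simp only: num_rooted_forests_T_caterpillar)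
  moreover have "fib (2 * Suc k + 3) = 2 * fib (2 * k + 3) + fib (2 * k + 2)"
    by (simp add: numeral_eq_Suc)
  ultimately show ?thesis
    by simp
qed

theorem theorem3:
  fixes n :: nat
  assumes "n \<ge> 3"
  shows "num_rooted_forests (T_caterpillar n) = 4 * fib (2 * n - 3) \<and>
         num_rooted_forests_at (T_caterpillar n) 3 = 4 * fib (2 * n - 5) \<and>
         num_rooted_forests_at (T_caterpillar n) n = 4 * fib (2 * n - 4)"
proof -
  obtain k where "n = k + 3"
    using assms by (metis add.commute le_Suc_ex)
  moreover have "2 * (k + 3) - 3 = 2 * k + 3" "2 * (k + 3) - 5 = 2 * k + 1"
    "2 * (k + 3) - 4 = 2 * k + 2"
    by simp_all
  ultimately show ?thesis
    by (simp only: num_rooted_forests_T_caterpillar num_rooted_forests_at_3_T_caterpillar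
        num_rooted_forests_at_last_T_caterpillar)
qed

end
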